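(* Let $X_1,\dots,X_n$ be exchangeable real random variables with finite expected value, and let $k,j\ge 1$ be integers with $j+k\le n$. Then $\Delta^{j}\mu_k\ge 0$ if $j$ is odd, and $\Delta^{j}\mu_k\le 0$ if $j$ is even.
   Context: For $1\le k\le n$, $\mu_k=\mathbb{E}[\max\{X_1,\dots,X_k\}]$. The discrete derivatives of the sequence $(\mu_k)_{k=1,\dots,n}$ are $\Delta^1\mu_k=\mu_{k+1}-\mu_k$ and, for $j\ge2$, $\Delta^{j}\mu_k=\Delta^{j-1}\mu_{k+1}-\Delta^{j-1}\mu_k$, defined whenever $k+j\le n$. *)

theory Defs
  imports "HOL-Probability.Probability"
begin

definition joint_law :: "'a measure \<Rightarrow> nat \<Rightarrow> (nat \<Rightarrow> 'a \<Rightarrow> real) \<Rightarrow> (nat \<Rightarrow> real) measure" where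
  "joint_law M n X =
     distr M (\<Pi>\<^sub>M i\<in>{1..n}. borel) (\<lambda>\<omega>. \<lambda>i\<in>{1..n}. X i \<omega>)"

text \<open>Measurability is part of the definition because \<open>distr\<close> is only meaningful for
  measurable maps.\<close>

definition exchangeable :: "'a measure \<Rightarrow> nat \<Rightarrow> (nat \<Rightarrow> 'a \<Rightarrow> real) \<Rightarrow> bool" where
  "exchangeable M n X \<longleftrightarrow>
     (\<forall>i\<in>{1..n}. X i \<in> borel_measurable M) \<and>
     (\<forall>\<pi>. \<pi> permutes {1..n} \<longrightarrow> joint_law M n (\<lambda>i. X (\<pi> i)) = joint_law M n X)"

text \<open>Only used for \<open>k \<ge> 1\<close>: \<open>Max\<close> of the empty set is unspecified.\<close>

definition expected_max :: "'a measure \<Rightarrow> (nat \<Rightarrow> 'a \<Rightarrow> real) \<Rightarrow> nat \<Rightarrow> real" where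
  "expected_max M X k = (\<integral>\<omega>. Max ((\<lambda>i. X i \<omega>) ` {1..k}) \<partial>M)"

text \<open>The recursion starts at order 0, with the sequence itself, so that order 1 is
  \<open>a (k + 1) - a k\<close>.  The value at \<open>k\<close> involves only \<open>a k, \<dots>, a (k + j)\<close>.\<close>

primrec discrete_deriv :: "nat \<Rightarrow> (nat \<Rightarrow> real) \<Rightarrow> nat \<Rightarrow> real" where
  "discrete_deriv 0 a k = a k"
| "discrete_deriv (Suc j) a k = discrete_deriv j a (k + 1) - discrete_deriv j a k"

end

theory Submission
  imports Defs
begin

text \<open>
  For disjoint index sets \<open>A\<close>, \<open>B\<close> with \<open>card A = k\<close> and \<open>card B = j\<close>, the number
  \<open>(-1)\<^sup>j\<^sup>+\<^sup>1 \<Delta>\<^sup>j \<mu>\<^sub>k\<close> is the expectation of the positive part of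
  \<open>Min\<^sub>B X - Max\<^sub>A X\<close>, hence nonnegative. By exchangeability \<open>E[Max\<^sub>A X]\<close> depends on
  \<open>card A\<close> only, which gives \<open>j = 1\<close>; the induction on \<open>j\<close> adds an index to \<open>B\<close> and rests on
  the pointwise identity \<open>(b - a)\<^sup>+ - (b - max a x)\<^sup>+ = (min b x - a)\<^sup>+\<close>.
\<close>

text \<open>A bijection from \<open>A\<close> to \<open>B\<close> is glued to one from
  \<open>S - A\<close> to \<open>S - B\<close>; these complements have equal size because
  \<open>S\<close> is finite. The identity off \<open>S\<close> makes the result a permutation of
  \<open>S\<close>.\<close>

lemma ex_permutes_image_eq:
  assumes "finite S" "A \<subseteq> S" "B \<subseteq> S" "card A = card B"
  shows "\<exists>\<pi>. \<pi> permutes S \<and> \<pi> ` A = B"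
proof -
  have fin: "finite A" "finite B"
    using assms finite_subset by blast+
  obtain f where f: "bij_betw f A B"
    using fin assms(4) finite_same_card_bij by blast
  have "card (S - A) = card (S - B)"
    using fin assms by (simp add: card_Diff_subset)
  then obtain g where g: "bij_betw g (S - A) (S - B)"
    using assms(1) finite_same_card_bij[of "S - A" "S - B"] by auto
  define p where "p x = (if x \<in> A then f x else if x \<in> S then g x else x)" for x
  have pA: "bij_betw p A B"
    using f by (rule bij_betw_cong[THEN iffD1, rotated]) (simp add: p_def)
  have "bij_betw p (S - A) (S - B)"
    using g by (rule bij_betw_cong[THEN iffD1, rotated]) (simp add: p_def)
  with pA have "bij_betw p (A \<union> (S - A)) (B \<union> (S - B))"
    by (rule bij_betw_combine) auto
  then have "bij_betw p S S"
    using assms(2,3) by (simp add: Un_absorb1)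
  then have "p permutes S"
    using assms(2) by (intro bij_imp_permutes) (auto simp: p_def)
  with pA show ?thesis
    by (auto simp: bij_betw_def)
qed

lemma integrable_Max_Min:
  fixes X :: "'i \<Rightarrow> 'a \<Rightarrow> real"
  assumes "finite A" "A \<noteq> {}" "\<And>i. i \<in> A \<Longrightarrow> integrable M (X i)"
  shows "integrable M (\<lambda>\<omega>. Max ((\<lambda>i. X i \<omega>) ` A))"
    and "integrable M (\<lambda>\<omega>. Min ((\<lambda>i. X i \<omega>) ` A))"
proof -
  have "integrable M (\<lambda>\<omega>. Max ((\<lambda>i. X i \<omega>) ` A)) \<and> integrable M (\<lambda>\<omega>. Min ((\<lambda>i. X i \<omega>) ` A))"
    using assms
    by (induction A rule: finite_ne_induct) (simp_all add: integrable_max integrable_min)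
  then show "integrable M (\<lambda>\<omega>. Max ((\<lambda>i. X i \<omega>) ` A))"
    and "integrable M (\<lambda>\<omega>. Min ((\<lambda>i. X i \<omega>) ` A))"
    by simp_all
qed

text \<open>Some permutation of \<open>{1..n}\<close> carries \<open>{1..card A}\<close> onto
  \<open>A\<close>, and the expected maximum of the first \<open>card A\<close> coordinates depends
  only on the joint law, which the permutation preserves.\<close>

lemma exchangeable_integral_Max:
  assumes "exchangeable M n X" "A \<subseteq> {1..n}" "A \<noteq> {}"
  shows "(\<integral>\<omega>. Max ((\<lambda>i. X i \<omega>) ` A) \<partial>M) = expected_max M X (card A)"
proof -
  let ?P = "\<Pi>\<^sub>M i\<in>{1..n}. borel :: real measure"
  let ?k = "card A"
  have fin: "finite A"
    using assms(2) finite_subset by blast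
  have k: "?k \<le> n" "1 \<le> ?k"
    using card_mono[OF _ assms(2)] fin assms(3) by (auto simp: Suc_le_eq card_gt_0_iff)
  obtain \<pi> where \<pi>: "\<pi> permutes {1..n}" "\<pi> ` {1..?k} = A"
    using ex_permutes_image_eq[of "{1..n}" "{1..?k}" A] assms(2) k by auto
  have X: "X i \<in> borel_measurable M" if "i \<in> {1..n}" for i
    using assms(1) that by (auto simp: exchangeable_def)
  have X\<pi>: "X (\<pi> i) \<in> borel_measurable M" if "i \<in> {1..n}" for i
    using X that permutes_in_image[OF \<pi>(1)] by blast
  have Max_measurable: "(\<lambda>x. Max (x ` {1..?k})) \<in> borel_measurable ?P"
  proof -
    have "(\<lambda>x. Max ((\<lambda>i. x i) ` {1..?k})) \<in> borel_measurable ?P"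
      using k by (intro borel_measurable_Max measurable_component_singleton) auto
    then show ?thesis by simp
  qed
  \<comment> \<open>Kept general in \<open>Y\<close> so that it serves both \<open>X\<close> and the
    permuted family.\<close>
  have law: "(\<integral>x. Max (x ` {1..?k}) \<partial>joint_law M n Y) = expected_max M Y ?k"
    if "\<And>i. i \<in> {1..n} \<Longrightarrow> Y i \<in> borel_measurable M" for Y
  proof -
    have "(\<integral>x. Max (x ` {1..?k}) \<partial>joint_law M n Y)
        = (\<integral>\<omega>. Max ((\<lambda>i\<in>{1..n}. Y i \<omega>) ` {1..?k}) \<partial>M)"
      unfolding joint_law_def
      by (intro integral_distr measurable_restrict that Max_measurable)
    \<comment> \<open>The restriction to \<open>{1..n}\<close> is invisible here, since
      \<open>{1..?k}\<close> lies inside it.\<close>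
    also have "\<dots> = expected_max M Y ?k"
      unfolding expected_max_def
      using k by (intro Bochner_Integration.integral_cong refl arg_cong[where f = Max] image_cong) auto
    finally show ?thesis .
  qed
  have "(\<integral>\<omega>. Max ((\<lambda>i. X i \<omega>) ` A) \<partial>M) = expected_max M (\<lambda>i. X (\<pi> i)) ?k"
    unfolding expected_max_def image_image[of "\<lambda>i. X i _" \<pi>, symmetric] \<pi>(2) ..
  also have "\<dots> = expected_max M X ?k"
    using law[of "\<lambda>i. X (\<pi> i)", OF X\<pi>] law[of X, OF X] assms(1) \<pi>(1)
    unfolding exchangeable_def by metis
  finally show ?thesis .
qed

text \<open>If x \<le> a, both sides vanish. If x > a, the left side is the length of the part of
  the interval from a to b that lies below x.\<close>

lemma pos_part_diff_max:
  fixes a b x :: real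
  shows "max 0 (b - a) - max 0 (b - max x a) = max 0 (min x b - a)"
  by (simp add: max_def min_def)

text \<open>The set \<open>A\<close> varies in the induction because the step uses the hypothesis
  for both \<open>A\<close> and \<open>insert x A\<close>.\<close>

lemma discrete_deriv_expected_max:
  assumes exch: "exchangeable M n X"
    and int: "\<And>i. i \<in> {1..n} \<Longrightarrow> integrable M (X i)"
    and "finite B" "B \<noteq> {}" "B \<subseteq> {1..n}" "A \<subseteq> {1..n}" "A \<noteq> {}" "A \<inter> B = {}"
  shows "(-1) ^ (card B + 1) * discrete_deriv (card B) (expected_max M X) (card A)
    = (\<integral>\<omega>. max 0 (Min ((\<lambda>i. X i \<omega>) ` B) - Max ((\<lambda>i. X i \<omega>) ` A)) \<partial>M)"
  using assms(3-8)
proof (induction B arbitrary: A rule: finite_ne_induct)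
  case (singleton x)
  have fin: "finite A"
    using singleton.prems(2) finite_subset by blast
  have ins: "insert x A \<subseteq> {1..n}" "x \<notin> A"
    using singleton.prems by auto
  have "expected_max M X (card A + 1) - expected_max M X (card A)
      = (\<integral>\<omega>. Max ((\<lambda>i. X i \<omega>) ` insert x A) \<partial>M) - (\<integral>\<omega>. Max ((\<lambda>i. X i \<omega>) ` A) \<partial>M)"
    using exchangeable_integral_Max[OF exch ins(1)] ins(2) fin
      exchangeable_integral_Max[OF exch singleton.prems(2,3)] by simp
  also have "\<dots> = (\<integral>\<omega>. Max ((\<lambda>i. X i \<omega>) ` insert x A) - Max ((\<lambda>i. X i \<omega>) ` A) \<partial>M)"
    using fin singleton.prems(3) ins(1)
    by (intro Bochner_Integration.integral_diff[symmetric] integrable_Max_Min int) auto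
  \<comment> \<open>Adding an index raises a maximum by the positive part of the new value minus the
    old maximum.\<close>
  also have "\<dots> = (\<integral>\<omega>. max 0 (Min ((\<lambda>i. X i \<omega>) ` {x}) - Max ((\<lambda>i. X i \<omega>) ` A)) \<partial>M)"
    using fin singleton.prems(3) by (intro Bochner_Integration.integral_cong refl) auto
  finally show ?case by simp
next
  case (insert x B)
  let ?G = "\<lambda>A B \<omega>. max 0 (Min ((\<lambda>i. X i \<omega>) ` B) - Max ((\<lambda>i. X i \<omega>) ` A))"
  have fin: "finite A"
    using insert.prems(2) finite_subset by blast
  have ins: "insert x A \<subseteq> {1..n}" "x \<notin> A" "B \<subseteq> {1..n}" "A \<inter> B = {}" "insert x A \<inter> B = {}"
    using insert.prems insert.hyps by auto
  have integrable: "integrable M (?G A' B)" if "A' \<subseteq> {1..n}" "A' \<noteq> {}" for A'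
    using that ins(3) insert.hyps finite_subset[OF that(1)]
    by (intro integrable_max Bochner_Integration.integrable_diff integrable_Max_Min int) auto
  \<comment> \<open>The extra sign reverses the recursive difference, and the shifted argument
    \<open>card A + 1\<close> is \<open>card (insert x A)\<close>.\<close>
  have "(-1) ^ (card (insert x B) + 1) * discrete_deriv (card (insert x B)) (expected_max M X) (card A)
      = (-1) ^ (card B + 1) * discrete_deriv (card B) (expected_max M X) (card A)
        - (-1) ^ (card B + 1) * discrete_deriv (card B) (expected_max M X) (card (insert x A))"
    using insert.hyps fin ins(2) by (simp add: algebra_simps)
  also have "\<dots> = (\<integral>\<omega>. ?G A B \<omega> \<partial>M) - (\<integral>\<omega>. ?G (insert x A) B \<omega> \<partial>M)"
    using insert.IH[of A] insert.IH[of "insert x A"] insert.prems ins by simp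
  also have "\<dots> = (\<integral>\<omega>. ?G A B \<omega> - ?G (insert x A) B \<omega> \<partial>M)"
    using ins(1) insert.prems(2,3)
    by (intro Bochner_Integration.integral_diff[symmetric] integrable) simp_all
  \<comment> \<open>Pointwise, this is \<open>pos_part_diff_max\<close> with b the minimum over
    \<open>B\<close>, a the maximum over \<open>A\<close> and x the value of the new
    variable.\<close>
  also have "\<dots> = (\<integral>\<omega>. ?G A (insert x B) \<omega> \<partial>M)"
    using fin insert.hyps insert.prems(3)
    by (intro Bochner_Integration.integral_cong refl) (simp add: pos_part_diff_max)
  finally show ?case .
qed

theorem corollary2p3:
  fixes M :: "'a measure" and X :: "nat \<Rightarrow> 'a \<Rightarrow> real" and n k j :: nat
  assumes "prob_space M"
    and "exchangeable M n X"
    and "\<And>i. i \<in> {1..n} \<Longrightarrow> integrable M (X i)"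
    and "1 \<le> k" and "1 \<le> j" and "j + k \<le> n"
  shows "(odd j \<longrightarrow> discrete_deriv j (expected_max M X) k \<ge> 0) \<and>
         (even j \<longrightarrow> discrete_deriv j (expected_max M X) k \<le> 0)"
proof -
  \<comment> \<open>Two adjacent blocks of sizes k and j serve as \<open>A\<close> and
    \<open>B\<close>; they fit into \<open>{1..n}\<close> because j + k \<le> n.\<close>
  have "(-1) ^ (card {k+1..k+j} + 1) * discrete_deriv (card {k+1..k+j}) (expected_max M X) (card {1..k})
      = (\<integral>\<omega>. max 0 (Min ((\<lambda>i. X i \<omega>) ` {k+1..k+j}) - Max ((\<lambda>i. X i \<omega>) ` {1..k})) \<partial>M)"
    using assms(4-6) by (intro discrete_deriv_expected_max[OF assms(2,3)]) auto
  also have "\<dots> \<ge> 0"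
    by (rule Bochner_Integration.integral_nonneg) simp
  finally have "(-1) ^ (j + 1) * discrete_deriv j (expected_max M X) k \<ge> 0"
    by simp
  then show ?thesis
    by auto
qed

end
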